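(* For any $0<\varepsilon<1$, let $0<q\le 1-\varepsilon$ (where $q=q(n)$ may depend on $n$). Then there exists a constant $c=c(\varepsilon)>0$ such that for every integer $n\ge 1/c$, \[\mathbb{P}\left(\mathrm{diam}(\mathcal{P}(n,q))< cn\right)\le n^{-1/10}.\]
   Context: Let $[n]=\{1,\dots,n\}$ and let $S_n$ be the set of permutations of $[n]$. For $\sigma\in S_n$, $\mathrm{Inv}(\sigma)=|\{(i,j): i<j,\ \sigma(i)>\sigma(j)\}|$. For $0<q\le 1$ the $(n,q)$-Mallows measure on $S_n$ is $\mu_{n,q}(\sigma)=q^{\mathrm{Inv}(\sigma)}/Z_{n,q}$, where $Z_{n,q}=\prod_{i=1}^n(1+q+\cdots+q^{i-1})$. The tangled path $\mathcal{P}(n,q)$ is the random graph with vertex set $[n]$ and edge set $\{i(i+1):1\le i<n\}\cup\{\sigma(i)\sigma(i+1):1\le i<n\}$, where $\sigma\sim\mu_{n,q}$ (multi-edges are identified). $\mathrm{diam}(G)$ is the graph diameter: the maximum over pairs of vertices of the length (number of edges) of a shortest path between them. *)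

theory Defs
  imports
    "HOL-Probability.Probability"
    "HOL-Combinatorics.Permutations"
    "Graph_Theory.Pair_Digraph"
    "Graph_Theory.Shortest_Path"
begin

section \<open>The Mallows measure\<close>

definition inversions :: "nat \<Rightarrow> (nat \<Rightarrow> nat) \<Rightarrow> nat" where
  "inversions n \<sigma> = card {(i, j). i \<in> {1..n} \<and> j \<in> {1..n} \<and> i < j \<and> \<sigma> i > \<sigma> j}"

definition mallows_Z :: "nat \<Rightarrow> real \<Rightarrow> real" where
  "mallows_Z n q = (\<Prod>i=1..n. \<Sum>j<i. q ^ j)"

definition mallows_density :: "nat \<Rightarrow> real \<Rightarrow> (nat \<Rightarrow> nat) \<Rightarrow> real" where
  "mallows_density n q \<sigma> =
     (if \<sigma> permutes {1..n} then q ^ inversions n \<sigma> / mallows_Z n q else 0)"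

text \<open>
  \<^const>\<open>embed_pmf\<close> is only meaningful for a nonnegative function with total mass 1;
  for \<open>q > 0\<close> this is shown in lemma \<open>pmf_mallows\<close> below.
\<close>

definition mallows :: "nat \<Rightarrow> real \<Rightarrow> (nat \<Rightarrow> nat) pmf" where
  "mallows n q = embed_pmf (mallows_density n q)"

text \<open>
  \<open>shift_cycle n b\<close> sends \<open>n + 1\<close> to \<open>b\<close> and shifts \<open>b, \<dots>, n\<close> up by one, so it is increasing
  on \<open>{1..n}\<close>. Every permutation of \<open>{1..n + 1}\<close> is uniquely \<open>shift_cycle n b \<circ> p\<close> with \<open>p\<close> a
  permutation of \<open>{1..n}\<close>, and it has \<open>n + 1 - b\<close> inversions more than \<open>p\<close>.
\<close>

definition shift_cycle :: "nat \<Rightarrow> nat \<Rightarrow> nat \<Rightarrow> nat" where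
  "shift_cycle n b x = (if x = Suc n then b else if b \<le> x \<and> x \<le> n then Suc x else x)"

definition unshift_cycle :: "nat \<Rightarrow> nat \<Rightarrow> nat \<Rightarrow> nat" where
  "unshift_cycle n b y = (if y = b then Suc n else if b < y \<and> y \<le> Suc n then y - 1 else y)"

lemma unshift_shift: "b \<in> {1..Suc n} \<Longrightarrow> unshift_cycle n b (shift_cycle n b x) = x"
  by (auto simp: shift_cycle_def unshift_cycle_def)

lemma shift_unshift: "b \<in> {1..Suc n} \<Longrightarrow> shift_cycle n b (unshift_cycle n b x) = x"
  by (auto simp: shift_cycle_def unshift_cycle_def)

lemma shift_cycle_permutes:
  assumes "b \<in> {1..Suc n}"
  shows "shift_cycle n b permutes {1..Suc n}"
proof -
  have "bij (shift_cycle n b)"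
    by (rule o_bij[of "unshift_cycle n b"]) (use assms in \<open>auto simp: fun_eq_iff shift_unshift unshift_shift\<close>)
  moreover have "shift_cycle n b x = x" if "x \<notin> {1..Suc n}" for x
    using assms that by (auto simp: shift_cycle_def)
  ultimately show ?thesis by (auto simp: permutes_def bij_iff)
qed

lemma unshift_cycle_permutes:
  assumes "b \<in> {1..Suc n}"
  shows "unshift_cycle n b permutes {1..Suc n}"
proof -
  have "bij (unshift_cycle n b)"
    by (rule o_bij[of "shift_cycle n b"]) (use assms in \<open>auto simp: fun_eq_iff shift_unshift unshift_shift\<close>)
  moreover have "unshift_cycle n b x = x" if "x \<notin> {1..Suc n}" for x
    using assms that by (auto simp: unshift_cycle_def)
  ultimately show ?thesis by (auto simp: permutes_def bij_iff)
qed

lemma inversions_shift_cycle: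
  assumes b: "b \<in> {1..Suc n}" and p: "p permutes {1..n}"
  shows "inversions (Suc n) (shift_cycle n b \<circ> p) = inversions n p + (Suc n - b)"
proof -
  let ?s = "shift_cycle n b \<circ> p"
  let ?A = "{(i, j). i \<in> {1..n} \<and> j \<in> {1..n} \<and> i < j \<and> p i > p j}"
  let ?B = "(\<lambda>y. (inv p y, Suc n)) ` {b..n}"
  have pin: "p i \<in> {1..n} \<longleftrightarrow> i \<in> {1..n}" for i
    using permutes_in_image[OF p] .
  have pS: "p (Suc n) = Suc n"
    using p by (auto simp: permutes_def)
  have ip: "inv p permutes {1..n}"
    using p by (rule permutes_inv)
  have mono: "?s i > ?s j \<longleftrightarrow> p i > p j" if "i \<in> {1..n}" "j \<in> {1..n}" for i j
    using pin[of i] pin[of j] that by (auto simp: shift_cycle_def)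
  have last: "?s i > ?s (Suc n) \<longleftrightarrow> p i \<in> {b..n}" if "i \<in> {1..n}" for i
    using pin[of i] that by (auto simp: shift_cycle_def pS)
  have B: "?B = {(i, j). i \<in> {1..n} \<and> j = Suc n \<and> p i \<in> {b..n}}"
  proof (intro equalityI subsetI)
    fix z assume "z \<in> ?B"
    then obtain y where y: "y \<in> {b..n}" "z = (inv p y, Suc n)" by auto
    moreover have "p (inv p y) = y" using p by (rule permutes_inverses)
    moreover have "inv p y \<in> {1..n}"
      using permutes_in_image[OF ip, of y] y b by auto
    ultimately show "z \<in> {(i, j). i \<in> {1..n} \<and> j = Suc n \<and> p i \<in> {b..n}}" by auto
  next
    fix z assume "z \<in> {(i, j). i \<in> {1..n} \<and> j = Suc n \<and> p i \<in> {b..n}}"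
    then obtain i where "z = (i, Suc n)" "p i \<in> {b..n}" by auto
    moreover have "inv p (p i) = i" using p by (rule permutes_inverses)
    ultimately show "z \<in> ?B" by (intro image_eqI[of _ _ "p i"]) auto
  qed
  have split: "{(i, j). i \<in> {1..Suc n} \<and> j \<in> {1..Suc n} \<and> i < j \<and> ?s i > ?s j} = ?A \<union> ?B"
    (is "?L = _")
  proof -
    have "?L = {(i, j). i \<in> {1..n} \<and> j \<in> {1..n} \<and> i < j \<and> ?s i > ?s j}
            \<union> {(i, j). i \<in> {1..n} \<and> j = Suc n \<and> ?s i > ?s (Suc n)}"
      by (auto simp: le_Suc_eq)
    also have "\<dots> = ?A \<union> ?B"
      unfolding B using mono last by blast
    finally show ?thesis .
  qed
  have "finite ?A"
    by (rule finite_subset[of _ "{1..n} \<times> {1..n}"]) auto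
  moreover have "?A \<inter> ?B = {}" by auto
  moreover have "card ?B = Suc n - b"
    using permutes_inj[OF ip] by (subst card_image) (auto simp: inj_on_def)
  ultimately show ?thesis
    unfolding inversions_def split by (subst card_Un_disjoint) auto
qed

lemma permutes_last: "\<sigma> permutes {1..Suc n} \<Longrightarrow> \<sigma> (Suc n) \<in> {1..Suc n}"
  by (subst permutes_in_image) auto

lemma unshift_cycle_comp_permutes:
  assumes "\<sigma> permutes {1..Suc n}"
  shows "unshift_cycle n (\<sigma> (Suc n)) \<circ> \<sigma> permutes {1..n}"
proof (rule permutes_superset)
  show "unshift_cycle n (\<sigma> (Suc n)) \<circ> \<sigma> permutes {1..Suc n}"
    using assms by (intro permutes_compose[OF assms] unshift_cycle_permutes permutes_last)
next
  fix x assume "x \<in> {1..Suc n} - {1..n}"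
  then have "x = Suc n" by auto
  then show "(unshift_cycle n (\<sigma> (Suc n)) \<circ> \<sigma>) x = x"
    by (simp add: unshift_cycle_def)
qed

lemma sum_inversions: "(\<Sum>\<sigma> | \<sigma> permutes {1..n}. q ^ inversions n \<sigma>) = mallows_Z n q"
proof (induction n)
  case 0
  show ?case by (simp add: inversions_def mallows_Z_def)
next
  case (Suc n)
  let ?P = "\<lambda>n. {\<sigma>. \<sigma> permutes {1..n::nat}}"
  have "(\<Sum>\<sigma>\<in>?P (Suc n). q ^ inversions (Suc n) \<sigma>)
      = (\<Sum>(b, p)\<in>{1..Suc n} \<times> ?P n. q ^ (inversions n p + (Suc n - b)))"
  proof (rule sum.reindex_bij_witness[where
        i = "\<lambda>(b, p). shift_cycle n b \<circ> p" and
        j = "\<lambda>\<sigma>. (\<sigma> (Suc n), unshift_cycle n (\<sigma> (Suc n)) \<circ> \<sigma>)"], goal_cases)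
    case (1 \<sigma>)
    then have "\<sigma> permutes {1..Suc n}" by simp
    note b = permutes_last[OF this]
    show ?case using shift_unshift[OF b] by (simp add: fun_eq_iff)
  next
    case (2 \<sigma>)
    then have \<sigma>: "\<sigma> permutes {1..Suc n}" by simp
    show ?case using permutes_last[OF \<sigma>] unshift_cycle_comp_permutes[OF \<sigma>] by simp
  next
    case (3 z)
    then obtain b p where z: "z = (b, p)" and b: "b \<in> {1..Suc n}" and p: "p permutes {1..n}"
      by blast
    have "p (Suc n) = Suc n" using permutes_not_in[OF p, of "Suc n"] by simp
    then show ?case using unshift_shift[OF b] by (simp add: z fun_eq_iff shift_cycle_def[of n b "Suc n"])
  next
    case (4 z)
    then obtain b p where z: "z = (b, p)" and b: "b \<in> {1..Suc n}" and p: "p permutes {1..n}"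
      by blast
    have "p permutes {1..Suc n}" using p by (rule permutes_subset) auto
    then show ?case using permutes_compose[OF _ shift_cycle_permutes[OF b]] by (simp add: z)
  next
    case (5 \<sigma>)
    then have \<sigma>: "\<sigma> permutes {1..Suc n}" by simp
    note b = permutes_last[OF \<sigma>] and p = unshift_cycle_comp_permutes[OF \<sigma>]
    have "shift_cycle n (\<sigma> (Suc n)) \<circ> (unshift_cycle n (\<sigma> (Suc n)) \<circ> \<sigma>) = \<sigma>"
      using shift_unshift[OF b] by (simp add: fun_eq_iff)
    then show ?case using inversions_shift_cycle[OF b p] by simp
  qed
  also have "\<dots> = (\<Sum>b\<in>{1..Suc n}. \<Sum>p\<in>?P n. q ^ inversions n p * q ^ (Suc n - b))"
    unfolding sum.cartesian_product power_add ..
  also have "\<dots> = mallows_Z n q * (\<Sum>b\<in>{1..Suc n}. q ^ (Suc n - b))"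
    unfolding Suc.IH[symmetric] sum_product by (rule sum.swap)
  also have "(\<Sum>b\<in>{1..Suc n}. q ^ (Suc n - b)) = (\<Sum>j<Suc n. q ^ j)"
    by (rule sum.reindex_bij_witness[where i = "\<lambda>j. Suc n - j" and j = "\<lambda>b. Suc n - b"]) auto
  also have "mallows_Z n q * \<dots> = mallows_Z (Suc n) q"
    by (simp add: mallows_Z_def)
  finally show ?case .
qed

lemma mallows_Z_pos: "0 < q \<Longrightarrow> 0 < mallows_Z n q"
  unfolding mallows_Z_def by (intro prod_pos ballI sum_pos) (auto simp: lessThan_empty_iff)

lemma pmf_mallows:
  assumes "0 < q"
  shows "pmf (mallows n q) \<sigma> = mallows_density n q \<sigma>"
proof -
  have fin: "finite {\<sigma>. \<sigma> permutes {1..n}}"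
    by (rule finite_permutations) simp
  have nonneg: "0 \<le> mallows_density n q \<sigma>" for \<sigma>
    using assms mallows_Z_pos[of q n] by (simp add: mallows_density_def)
  have "(\<integral>\<^sup>+ \<sigma>. ennreal (mallows_density n q \<sigma>) \<partial>count_space UNIV)
      = (\<Sum>\<sigma> | \<sigma> permutes {1..n}. ennreal (mallows_density n q \<sigma>))"
    by (rule nn_integral_count_space'[OF fin]) (auto simp: mallows_density_def)
  also have "\<dots> = ennreal (\<Sum>\<sigma> | \<sigma> permutes {1..n}. mallows_density n q \<sigma>)"
    using nonneg by (simp add: sum_ennreal)
  also have "(\<Sum>\<sigma> | \<sigma> permutes {1..n}. mallows_density n q \<sigma>) = 1"
    using sum_inversions[where q = q and n = n] mallows_Z_pos[OF assms, of n]
    by (simp add: mallows_density_def flip: sum_divide_distrib)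
  finally show ?thesis
    unfolding mallows_def using nonneg by (intro pmf_embed_pmf) auto
qed


section \<open>Tangled paths\<close>

text \<open>
  Undirected graphs are symmetric digraphs, as in \<^locale>\<open>pair_graph\<close>: an edge \<open>uv\<close> is the pair
  of arcs \<open>(u, v)\<close>, \<open>(v, u)\<close>. Arcs form a set, so multi-edges are identified.
\<close>

definition tangled_graph :: "nat \<Rightarrow> (nat \<Rightarrow> nat) \<Rightarrow> nat pair_pre_digraph" where
  "tangled_graph n \<sigma> =
     \<lparr> pverts = {1..n},
       parcs = symcl ({(i, i + 1) | i. 1 \<le> i \<and> i < n} \<union> {(\<sigma> i, \<sigma> (i + 1)) | i. 1 \<le> i \<and> i < n}) \<rparr>"

definition tangled_path :: "nat \<Rightarrow> real \<Rightarrow> nat pair_pre_digraph pmf" where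
  "tangled_path n q = map_pmf (tangled_graph n) (mallows n q)"

lemma pair_graph_tangled_graph:
  assumes "\<sigma> permutes {1..n}"
  shows "pair_graph (tangled_graph n \<sigma>)"
proof -
  let ?E = "{(i, i + 1) | i. 1 \<le> i \<and> i < n} \<union> {(\<sigma> i, \<sigma> (i + 1)) | i. 1 \<le> i \<and> i < n}"
  have im: "\<sigma> i \<in> {1..n} \<longleftrightarrow> i \<in> {1..n}" for i
    using permutes_in_image[OF assms] .
  have inj: "\<sigma> i = \<sigma> j \<longleftrightarrow> i = j" for i j
    using permutes_inj[OF assms] by (auto simp: inj_def)
  have sub: "?E \<subseteq> {1..n} \<times> {1..n}"
  proof -
    have "\<sigma> i \<in> {1..n} \<and> \<sigma> (i + 1) \<in> {1..n}" if "1 \<le> i" "i < n" for i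
      using that unfolding im by simp
    then show ?thesis by fastforce
  qed
  then have sub': "parcs (tangled_graph n \<sigma>) \<subseteq> {1..n} \<times> {1..n}"
    by (auto simp: tangled_graph_def symcl_def simp del: atLeastAtMost_iff)
  have loop: "u \<noteq> v" if "(u, v) \<in> parcs (tangled_graph n \<sigma>)" for u v
    using that by (auto simp: tangled_graph_def symcl_def inj)
  have fin: "finite (parcs (tangled_graph n \<sigma>))"
    using sub' by (rule finite_subset) simp
  have sym: "symmetric (with_proj (tangled_graph n \<sigma>))"
    by (auto simp: symmetric_def tangled_graph_def symcl_def sym_def)
  have verts: "pverts (tangled_graph n \<sigma>) = {1..n}"
    by (simp add: tangled_graph_def)
  show ?thesis
    by unfold_locales (use sub' loop fin sym verts in auto)
qed


section \<open>Diameter\<close>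

text \<open>
  \<^const>\<open>wf_digraph.\<mu>\<close> is the infimum of the costs of all walks, so with unit weights
  it is the number of edges of a shortest path (\<open>\<infinity>\<close> if there is none).
  Its defining equation requires \<^term>\<open>wf_digraph G\<close>, which every \<^locale>\<open>pair_graph\<close> satisfies.
\<close>

definition graph_dist :: "('a, 'b) pre_digraph \<Rightarrow> 'a \<Rightarrow> 'a \<Rightarrow> ereal" where
  "graph_dist G u v = wf_digraph.\<mu> G (\<lambda>_. 1) u v"

text \<open>The maximum is only meaningful for a finite, nonempty vertex set.\<close>

definition diam :: "('a, 'b) pre_digraph \<Rightarrow> ereal" where
  "diam G = Max {graph_dist G u v | u v. u \<in> verts G \<and> v \<in> verts G}"

end

theory Submission
  imports Defs
begin

text \<open>
  Call \<open>k\<close> a split point of \<open>\<sigma>\<close> if \<open>\<sigma>\<close> maps \<open>{1..k}\<close> onto itself. Then only the edges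
  \<open>k (k + 1)\<close> and \<open>\<sigma>(k) \<sigma>(k + 1)\<close> join \<open>{1..k}\<close> to the rest, and no edge passes two split points
  at once. A walk from \<open>1\<close> to \<open>n\<close> therefore has at least as many edges as there are split points
  below \<open>n\<close> (lemma \<open>diam_tangled_ge\<close>), and it suffices that their number is linear in \<open>n\<close> with
  high probability. This follows from Chebyshev's inequality.

  A permutation that splits at \<open>k\<close> is a permutation of \<open>{1..k}\<close> next to one of \<open>{k + 1..n}\<close>, with no
  inversions between the two parts. Hence the probability of a split at \<open>k\<close> is
  \<open>Z\<^sub>k Z\<^sub>n\<^sub>-\<^sub>k / Z\<^sub>n\<close>, and the probability of splits at \<open>j \<le> k\<close> is
  \<open>Z\<^sub>j Z\<^sub>k\<^sub>-\<^sub>j Z\<^sub>n\<^sub>-\<^sub>k / Z\<^sub>n\<close>. In terms of \<open>(q)\<^sub>m = (1 - q) (1 - q\<^sup>2) \<dots> (1 - q\<^sup>m)\<close> the powers of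
  \<open>1 - q\<close> cancel and these become \<open>(q)\<^sub>k (q)\<^sub>n\<^sub>-\<^sub>k / (q)\<^sub>n\<close> and
  \<open>(q)\<^sub>j (q)\<^sub>k\<^sub>-\<^sub>j (q)\<^sub>n\<^sub>-\<^sub>k / (q)\<^sub>n\<close>. As \<open>(q)\<^sub>m\<close> decreases in \<open>m\<close> to a positive limit, the
  first is bounded below uniformly in \<open>k\<close> and \<open>n\<close> (\<open>prob_split_ge\<close>), so the mean number of split points
  is linear. The covariance of splits at \<open>j\<close> and \<open>k\<close> is at most a constant times \<open>q\<^bsup>|k - j|\<^esup>\<close>
  (\<open>cov_split_le\<close>), because it is governed by the tail product \<open>(1 - q\<^bsup>k-j+1\<^esup>) (1 - q\<^bsup>k-j+2\<^esup>) \<dots>\<close>,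
  so the variance is at most linear. All constants depend on \<open>q\<close> only through an upper
  bound \<open>1 - \<epsilon>\<close>, and the failure probability is \<open>O(1/n)\<close>.
\<close>

section \<open>Split points separate the graph\<close>

definition splits_at :: "(nat \<Rightarrow> nat) \<Rightarrow> nat \<Rightarrow> bool" where
  "splits_at \<sigma> k \<longleftrightarrow> \<sigma> ` {1..k} = {1..k}"

text \<open>
  Relabelling by \<open>\<sigma>\<close> does not move a vertex across a split point; so both paths see the split points
  in the same way.
\<close>

lemma splits_at_less_iff:
  assumes "\<sigma> permutes {1..n}" "splits_at \<sigma> k" "i \<ge> 1"
  shows "k < \<sigma> i \<longleftrightarrow> k < i"
proof -
  have "\<sigma> i \<in> \<sigma> ` {1..k} \<longleftrightarrow> i \<in> {1..k}"
    using permutes_inj[OF assms(1)] by (simp add: inj_image_mem_iff)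
  moreover have "\<sigma> i \<ge> 1"
    using permutes_in_image[OF assms(1), of i] permutes_not_in[OF assms(1), of i] assms(3)
    by (cases "i \<in> {1..n}") auto
  ultimately show ?thesis using assms(2,3) by (auto simp: splits_at_def)
qed

text \<open>
  A lower bound on distances by duality: a potential that grows by at most one along every arc
  certifies that walks are long.
\<close>

lemma graph_dist_ge_potential:
  fixes f :: "'a \<Rightarrow> nat"
  assumes "wf_digraph G" and step: "\<And>e. e \<in> arcs G \<Longrightarrow> f (head G e) \<le> f (tail G e) + 1"
  shows "ereal (real (f v) - real (f u)) \<le> graph_dist G u v"
proof -
  interpret wf_digraph G by fact
  have "real (f v) - real (f u) \<le> awalk_cost (\<lambda>_. 1) p" if "awalk u p v" for p
    using that
  proof (induction p arbitrary: u)
    case Nil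
    then show ?case by (simp add: awalk_Nil_iff)
  next
    case (Cons e p)
    then have "e \<in> arcs G" "u = tail G e" "awalk (head G e) p v"
      by (simp_all add: awalk_Cons_iff)
    with Cons.IH[of "head G e"] step[of e] show ?case by simp
  qed
  then show ?thesis unfolding graph_dist_def \<mu>_def by (auto intro: INF_greatest)
qed

text \<open>
  The potential of a vertex is the number of split points below it. It is invariant under \<open>\<sigma>\<close>, so
  an arc of the path \<open>\<sigma>(1), \<dots>, \<sigma>(n)\<close> changes it just as the corresponding arc of the
  path \<open>1, \<dots>, n\<close> does, that is, by at most one.
\<close>

lemma diam_tangled_ge:
  assumes "\<sigma> permutes {1..n}" "n \<ge> 1"
  shows "ereal (real (card {k \<in> {1..<n}. splits_at \<sigma> k})) \<le> diam (with_proj (tangled_graph n \<sigma>))"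
proof -
  let ?G = "with_proj (tangled_graph n \<sigma>)"
  interpret pair_graph "tangled_graph n \<sigma>" by (rule pair_graph_tangled_graph) fact
  have verts: "verts ?G = {1..n}" by (simp add: tangled_graph_def)
  define f where "f v = card {k \<in> {1..<n}. splits_at \<sigma> k \<and> k < v}" for v
  have f_\<sigma>: "f (\<sigma> i) = f i" if "i \<ge> 1" for i
    unfolding f_def using splits_at_less_iff[OF assms(1) _ that]
    by (intro arg_cong[of _ _ card] Collect_cong) blast
  have f_Suc: "f i \<le> f (Suc i) \<and> f (Suc i) \<le> f i + 1" for i
  proof
    show "f i \<le> f (Suc i)" unfolding f_def by (intro card_mono) auto
    have "f (Suc i) \<le> card (insert i {k \<in> {1..<n}. splits_at \<sigma> k \<and> k < i})"
      unfolding f_def by (intro card_mono) auto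
    also have "\<dots> \<le> f i + 1" unfolding f_def by (simp add: card_insert_if)
    finally show "f (Suc i) \<le> f i + 1" .
  qed
  have "f (head ?G e) \<le> f (tail ?G e) + 1" if "e \<in> arcs ?G" for e
    using that f_Suc by (auto simp: tangled_graph_def symcl_def f_\<sigma> intro: le_SucI)
  then have "ereal (real (f n) - real (f 1)) \<le> graph_dist ?G 1 n"
    by (intro graph_dist_ge_potential wf_digraph)
  also have "\<dots> \<le> diam ?G"
  proof -
    have "finite {graph_dist ?G u v |u v. u \<in> verts ?G \<and> v \<in> verts ?G}"
      by (rule finite_subset[of _ "\<Union>u\<in>{1..n}. graph_dist ?G u ` {1..n}"])
        (unfold verts, blast, simp)
    moreover have "graph_dist ?G 1 n \<in> {graph_dist ?G u v |u v. u \<in> verts ?G \<and> v \<in> verts ?G}"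
      unfolding verts mem_Collect_eq using assms(2) by (intro exI[of _ 1] exI[of _ n]) auto
    ultimately show ?thesis unfolding diam_def by (rule Max_ge)
  qed
  also have "f 1 = 0" by (simp add: f_def card_eq_0_iff)
  also have "f n = card {k \<in> {1..<n}. splits_at \<sigma> k}"
    unfolding f_def by (rule arg_cong[of _ _ card]) auto
  finally show ?thesis by simp
qed

section \<open>The law of the split points\<close>

text \<open>
  Sums over permutations are evaluated by recursion on the value \<open>b\<close> taken at the last position.
\<close>

lemma sum_permutes_Suc:
  "(\<Sum>\<sigma> | \<sigma> permutes {1..Suc n}. g \<sigma>)
    = (\<Sum>b\<in>{1..Suc n}. \<Sum>p | p permutes {1..n}. g (shift_cycle n b \<circ> p))"
proof -
  have "(\<Sum>\<sigma> | \<sigma> permutes {1..Suc n}. g \<sigma>)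
      = (\<Sum>(b, p)\<in>{1..Suc n} \<times> {p. p permutes {1..n}}. g (shift_cycle n b \<circ> p))"
  proof (rule sum.reindex_bij_witness[where
        i = "\<lambda>(b, p). shift_cycle n b \<circ> p" and
        j = "\<lambda>\<sigma>. (\<sigma> (Suc n), unshift_cycle n (\<sigma> (Suc n)) \<circ> \<sigma>)"], goal_cases)
    case (1 \<sigma>)
    then have "\<sigma> permutes {1..Suc n}" by simp
    from shift_unshift[OF permutes_last[OF this]] show ?case by (simp add: fun_eq_iff)
  next
    case (2 \<sigma>)
    then have \<sigma>: "\<sigma> permutes {1..Suc n}" by simp
    show ?case using permutes_last[OF \<sigma>] unshift_cycle_comp_permutes[OF \<sigma>] by simp
  next
    case (3 z)
    then obtain b p where z: "z = (b, p)" and b: "b \<in> {1..Suc n}" and p: "p permutes {1..n}"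
      by blast
    have "p (Suc n) = Suc n" using permutes_not_in[OF p, of "Suc n"] by simp
    then show ?case
      using unshift_shift[OF b] by (simp add: z fun_eq_iff shift_cycle_def[of n b "Suc n"])
  next
    case (4 z)
    then obtain b p where z: "z = (b, p)" and b: "b \<in> {1..Suc n}" and p: "p permutes {1..n}"
      by blast
    have "p permutes {1..Suc n}" using p by (rule permutes_subset) auto
    then show ?case using permutes_compose[OF _ shift_cycle_permutes[OF b]] by (simp add: z)
  next
    case (5 \<sigma>)
    then have "\<sigma> permutes {1..Suc n}" by simp
    from shift_unshift[OF permutes_last[OF this]]
    have "shift_cycle n (\<sigma> (Suc n)) \<circ> (unshift_cycle n (\<sigma> (Suc n)) \<circ> \<sigma>) = \<sigma>"
      by (simp add: fun_eq_iff)
    then show ?case by simp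
  qed
  then show ?thesis by (simp add: sum.cartesian_product)
qed

text \<open>
  Appending the last value \<open>b\<close> destroys a split at \<open>k\<close> exactly if \<open>b \<le> k\<close>: then \<open>b\<close> is
  missing from the image of \<open>{1..k}\<close>, and otherwise the values up to \<open>k\<close> are not shifted.
\<close>

lemma splits_at_shift_cycle:
  assumes p: "p permutes {1..n}" and b: "b \<in> {1..Suc n}" and k: "k \<le> n"
  shows "splits_at (shift_cycle n b \<circ> p) k \<longleftrightarrow> k < b \<and> splits_at p k"
proof -
  have id: "shift_cycle n b ` {1..k} = {1..k}" if "k < b"
  proof -
    have "shift_cycle n b ` {1..k} = id ` {1..k}"
      using that k by (intro image_cong) (auto simp: shift_cycle_def)
    then show ?thesis by simp
  qed
  have "k < b" if "splits_at (shift_cycle n b \<circ> p) k"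
  proof (rule ccontr)
    assume "\<not> k < b"
    then have "b \<in> (shift_cycle n b \<circ> p) ` {1..k}"
      using that b unfolding splits_at_def by simp
    then obtain i where i: "i \<in> {1..k}" "shift_cycle n b (p i) = b" by auto
    moreover have "p i \<in> {1..n}" using permutes_in_image[OF p, of i] i k by auto
    ultimately show False by (auto simp: shift_cycle_def split: if_splits)
  qed
  moreover have "shift_cycle n b ` p ` {1..k} = shift_cycle n b ` {1..k} \<longleftrightarrow> p ` {1..k} = {1..k}"
    using permutes_inj[OF shift_cycle_permutes[OF b]] by (rule inj_image_eq_iff)
  ultimately show ?thesis using id unfolding splits_at_def image_comp[symmetric] by metis
qed

definition split_weight :: "nat \<Rightarrow> real \<Rightarrow> nat set \<Rightarrow> real" where
  "split_weight n q K = (\<Sum>\<sigma> | \<sigma> permutes {1..n} \<and> (\<forall>k\<in>K. splits_at \<sigma> k). q ^ inversions n \<sigma>)"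

lemma split_weight_empty: "split_weight n q {} = mallows_Z n q"
  unfolding split_weight_def using sum_inversions[where n = n and q = q] by simp

text \<open>Every permutation of \<open>{1..n}\<close> splits at \<open>n\<close>.\<close>

lemma split_weight_insert_self: "split_weight n q (insert n K) = split_weight n q K"
proof -
  have "splits_at \<sigma> n" if "\<sigma> permutes {1..n}" for \<sigma>
    unfolding splits_at_def using that by (rule permutes_image)
  then show ?thesis unfolding split_weight_def by (intro sum.cong) auto
qed

text \<open>
  To preserve the splits in \<open>K\<close>, the last value \<open>b\<close> must exceed the largest of them, \<open>m\<close>; it then
  contributes \<open>n + 1 - b\<close> inversions, which ranges over \<open>0, \<dots>, n - m\<close>.
\<close>

lemma split_weight_Suc:
  assumes m: "m \<in> K" "K \<subseteq> {..m}" "m \<le> n"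
  shows "split_weight (Suc n) q K = split_weight n q K * (\<Sum>j<Suc n - m. q ^ j)"
proof -
  let ?S = "\<lambda>\<sigma>. \<forall>k\<in>K. splits_at \<sigma> k"
  have fin: "finite {\<sigma>. \<sigma> permutes {1..n::nat}}" for n by (rule finite_permutations) simp
  have filt: "split_weight n q K = (\<Sum>\<sigma> | \<sigma> permutes {1..n}. if ?S \<sigma> then q ^ inversions n \<sigma> else 0)" for n
    unfolding split_weight_def by (subst sum.inter_filter[OF fin, symmetric]) (simp add: conj_commute)
  have eq: "(if ?S (shift_cycle n b \<circ> p) then q ^ inversions (Suc n) (shift_cycle n b \<circ> p) else 0)
      = (if m < b then q ^ (Suc n - b) else 0) * (if ?S p then q ^ inversions n p else 0)"
    if "b \<in> {1..Suc n}" "p permutes {1..n}" for b p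
  proof -
    have "?S (shift_cycle n b \<circ> p) \<longleftrightarrow> m < b \<and> ?S p"
      using splits_at_shift_cycle[OF that(2,1)] m by (meson atMost_iff le_less_trans order_trans subsetD)
    then show ?thesis using inversions_shift_cycle[OF that] by (simp add: power_add)
  qed
  have "split_weight (Suc n) q K = (\<Sum>b\<in>{1..Suc n}. \<Sum>p | p permutes {1..n}.
      (if m < b then q ^ (Suc n - b) else 0) * (if ?S p then q ^ inversions n p else 0))"
    unfolding filt sum_permutes_Suc
    by (rule sum.cong[OF refl], rule sum.cong[OF refl], rule eq) auto
  also have "\<dots> = (\<Sum>b\<in>{1..Suc n}. if m < b then q ^ (Suc n - b) else 0) * split_weight n q K"
    unfolding filt sum_product ..
  also have "(\<Sum>b\<in>{1..Suc n}. if m < b then q ^ (Suc n - b) else 0) = (\<Sum>b\<in>{b \<in> {1..Suc n}. m < b}. q ^ (Suc n - b))"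
    by (subst sum.inter_filter) simp_all
  also have "\<dots> = (\<Sum>j<Suc n - m. q ^ j)"
    by (rule sum.reindex_bij_witness[where i = "\<lambda>j. Suc n - j" and j = "\<lambda>b. Suc n - b"]) auto
  finally show ?thesis by (simp add: mult.commute)
qed

text \<open>
  The part of the permutation above its last prescribed split point is an arbitrary permutation of
  \<open>n - m\<close> points and contributes an independent factor. Iterating this from the right gives the
  product formulas for one and for two split points.
\<close>

lemma split_weight_Max:
  assumes m: "m \<in> K" "K \<subseteq> {..m}" and "m \<le> n"
  shows "split_weight n q K = split_weight m q K * mallows_Z (n - m) q"
  using \<open>m \<le> n\<close>
proof (induction rule: dec_induct)
  case base
  show ?case by (simp add: mallows_Z_def)
next
  case (step n)
  then show ?case using split_weight_Suc[OF m, of n q] by (simp add: mallows_Z_def Suc_diff_le)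
qed

lemma split_weight_single:
  assumes "k \<le> n"
  shows "split_weight n q {k} = mallows_Z k q * mallows_Z (n - k) q"
  using split_weight_Max[of k "{k}" n q] assms
  by (simp add: split_weight_insert_self split_weight_empty)

lemma split_weight_pair:
  assumes "j \<le> k" "k \<le> n"
  shows "split_weight n q {j, k} = mallows_Z j q * mallows_Z (k - j) q * mallows_Z (n - k) q"
  using split_weight_Max[of k "{j, k}" n q] split_weight_insert_self[of k q "{j}"] assms
  by (simp add: insert_commute split_weight_single)

lemma prob_mallows_splits:
  assumes "0 < q"
  shows "measure_pmf.prob (mallows n q) {\<sigma>. \<forall>k\<in>K. splits_at \<sigma> k} = split_weight n q K / mallows_Z n q"
proof -
  let ?A = "{\<sigma>. \<forall>k\<in>K. splits_at \<sigma> k}" and ?P = "{\<sigma>. \<sigma> permutes {1..n}}"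
  have fin: "finite ?P" by (rule finite_permutations) simp
  have "set_pmf (mallows n q) \<subseteq> ?P"
    using pmf_mallows[OF assms] by (auto simp: set_pmf_iff mallows_density_def split: if_splits)
  then have "?A \<inter> set_pmf (mallows n q) = (?P \<inter> ?A) \<inter> set_pmf (mallows n q)" by blast
  then have "measure_pmf.prob (mallows n q) ?A = measure_pmf.prob (mallows n q) (?P \<inter> ?A)"
    using measure_Int_set_pmf[of "mallows n q" ?A] measure_Int_set_pmf[of "mallows n q" "?P \<inter> ?A"]
    by simp
  also have "\<dots> = (\<Sum>\<sigma>\<in>?P \<inter> ?A. mallows_density n q \<sigma>)"
    using fin by (subst measure_measure_pmf_finite) (auto simp: pmf_mallows[OF assms])
  also have "\<dots> = split_weight n q K / mallows_Z n q"
    unfolding split_weight_def sum_divide_distrib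
    by (rule sum.cong) (auto simp: mallows_density_def)
  finally show ?thesis .
qed

section \<open>Finite q-Pochhammer symbols\<close>

text \<open>
  This is \<open>(q)\<^sub>m\<close>, which is \<open>(1 - q)\<^sup>m\<close> times the \<open>q\<close>-analogue \<open>Z\<^sub>m\<close> of \<open>m!\<close>. Unlike
  \<open>Z\<^sub>m\<close> it is monotone and bounded from both sides in \<open>m\<close>.
\<close>

definition q_poch :: "real \<Rightarrow> nat \<Rightarrow> real" where
  "q_poch q m = (\<Prod>i=1..m. 1 - q ^ i)"

lemma mallows_Z_q_poch:
  assumes "q < 1"
  shows "mallows_Z m q = q_poch q m / (1 - q) ^ m"
proof -
  have "mallows_Z m q = (\<Prod>i=1..m. (1 - q ^ i) / (1 - q))"
    unfolding mallows_Z_def using assms by (simp add: sum_gp_strict)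
  then show ?thesis by (simp add: q_poch_def prod_dividef)
qed

lemma q_poch_pos: "0 \<le> q \<Longrightarrow> q < 1 \<Longrightarrow> 0 < q_poch q m"
  unfolding q_poch_def by (intro prod_pos) (auto simp: power_less_one_iff)

lemma q_poch_antimono:
  assumes "0 \<le> q" "q < 1" "l \<le> m"
  shows "q_poch q m \<le> q_poch q l"
  using \<open>l \<le> m\<close>
proof (induction rule: dec_induct)
  case base
  show ?case by simp
next
  case (step m)
  have "q_poch q m * (1 - q ^ Suc m) \<le> q_poch q m * 1"
    using assms q_poch_pos[of q m] by (intro mult_left_mono) auto
  then show ?case using step.IH by (simp add: q_poch_def)
qed

lemma q_poch_ratio_ge:
  assumes "0 \<le> q" "q < 1" "l \<le> m"
  shows "q_poch q m / q_poch q l \<ge> 1 - q ^ l / (1 - q)"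
proof -
  have "{1..m} = {1..l} \<union> {l<..m}" "{1..l} \<inter> {l<..m} = {}" using assms(3) by auto
  then have "q_poch q m = q_poch q l * (\<Prod>i\<in>{l<..m}. 1 - q ^ i)"
    unfolding q_poch_def by (simp add: prod.union_disjoint)
  then have "q_poch q m / q_poch q l = (\<Prod>i\<in>{l<..m}. 1 - q ^ i)"
    using q_poch_pos[OF assms(1,2), of l] by simp
  moreover have "1 - (\<Sum>i\<in>{l<..m}. q ^ i) \<le> (\<Prod>i\<in>{l<..m}. 1 - q ^ i)"
    using assms by (intro Weierstrass_prod_ineq) (auto simp: power_le_one)
  moreover have "(\<Sum>i\<in>{l<..m}. q ^ i) \<le> q ^ l / (1 - q)"
  proof -
    have "(\<Sum>i\<in>{l<..m}. q ^ i) \<le> (\<Sum>i\<in>{l..m}. q ^ i)"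
      using assms by (intro sum_mono2) auto
    also have "\<dots> = (q ^ l - q ^ Suc m) / (1 - q)"
      using assms by (subst sum_gp) auto
    also have "\<dots> \<le> q ^ l / (1 - q)"
      using assms by (intro divide_right_mono) auto
    finally show ?thesis .
  qed
  ultimately show ?thesis by linarith
qed

text \<open>
  Each factor satisfies \<open>1 - x \<ge> exp (- x / (1 - x))\<close>, which turns the product into a geometric series
  in the exponent.
\<close>

lemma q_poch_ge:
  assumes "0 \<le> q" "q < 1"
  shows "q_poch q m \<ge> exp (- 1 / (1 - q)\<^sup>2)"
proof -
  have factor: "1 - q ^ i \<ge> exp (- (q ^ i / (1 - q)))" if "i \<ge> 1" for i
  proof -
    have qi: "0 \<le> q ^ i" "q ^ i \<le> q" "q ^ i < 1"
      using assms that power_decreasing[of 1 i q] by auto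
    (* The denominator 1 - q ^ i is replaced by the smaller 1 - q, so that the exponents sum up. *)
    have "1 / (1 - q ^ i) = 1 + q ^ i / (1 - q ^ i)" using qi by (simp add: field_simps)
    also have "\<dots> \<le> 1 + q ^ i / (1 - q)"
      using qi assms by (intro add_left_mono divide_left_mono mult_pos_pos) auto
    also have "\<dots> \<le> exp (q ^ i / (1 - q))" by (rule exp_ge_add_one_self)
    finally have "inverse (exp (q ^ i / (1 - q))) \<le> inverse (1 / (1 - q ^ i))"
      using qi by (intro le_imp_inverse_le) auto
    then show ?thesis by (simp add: exp_minus)
  qed
  have "(\<Sum>i=1..m. q ^ i) \<le> (\<Sum>i\<le>m. q ^ i)" using assms by (intro sum_mono2) auto
  also have "\<dots> = (1 - q ^ Suc m) / (1 - q)"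
    using assms by (subst sum_gp0) auto
  also have "\<dots> \<le> 1 / (1 - q)"
    using assms by (intro divide_right_mono) auto
  finally have "(\<Sum>i=1..m. q ^ i) / (1 - q) \<le> 1 / (1 - q) / (1 - q)"
    using assms by (intro divide_right_mono) auto
  then have "exp (- 1 / (1 - q)\<^sup>2) \<le> exp (\<Sum>i=1..m. - (q ^ i / (1 - q)))"
    by (simp add: sum_negf power2_eq_square flip: sum_divide_distrib)
  also have "\<dots> = (\<Prod>i=1..m. exp (- (q ^ i / (1 - q))))" by (rule exp_sum) simp
  also have "\<dots> \<le> q_poch q m"
    unfolding q_poch_def using factor by (intro prod_mono) auto
  finally show ?thesis .
qed

section \<open>Mean and covariance of the split points\<close>

lemma prob_split:
  assumes "0 < q" "q < 1" "k \<le> n"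
  shows "measure_pmf.prob (mallows n q) {\<sigma>. splits_at \<sigma> k}
    = q_poch q k * q_poch q (n - k) / q_poch q n"
proof -
  have "(1 - q) ^ n = (1 - q) ^ k * (1 - q) ^ (n - k)"
    using assms by (simp flip: power_add)
  then show ?thesis
    using prob_mallows_splits[OF assms(1), of n "{k}"] assms
    by (simp add: split_weight_single mallows_Z_q_poch)
qed

lemma prob_split_pair:
  assumes "0 < q" "q < 1" "j \<le> k" "k \<le> n"
  shows "measure_pmf.prob (mallows n q) ({\<sigma>. splits_at \<sigma> j} \<inter> {\<sigma>. splits_at \<sigma> k})
    = q_poch q j * q_poch q (k - j) * q_poch q (n - k) / q_poch q n"
proof -
  have "(1 - q) ^ n = (1 - q) ^ j * (1 - q) ^ (k - j) * (1 - q) ^ (n - k)"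
    using assms by (simp flip: power_add)
  moreover have "{\<sigma>. splits_at \<sigma> j} \<inter> {\<sigma>. splits_at \<sigma> k} = {\<sigma>. \<forall>l\<in>{j, k}. splits_at \<sigma> l}"
    by auto
  ultimately show ?thesis
    using prob_mallows_splits[OF assms(1), of n "{j, k}"] assms
    by (simp add: split_weight_pair mallows_Z_q_poch)
qed

lemma prob_split_ge:
  assumes "0 < q" "q < 1" "k \<le> n"
  shows "measure_pmf.prob (mallows n q) {\<sigma>. splits_at \<sigma> k} \<ge> exp (- 1 / (1 - q)\<^sup>2)"
proof -
  have "q_poch q n \<le> q_poch q (n - k)"
    using assms by (intro q_poch_antimono) auto
  then have "q_poch q k \<le> q_poch q k * q_poch q (n - k) / q_poch q n"
    using q_poch_pos[of q n] q_poch_pos[of q k] assms by (simp add: field_simps)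
  with q_poch_ge[of q k] show ?thesis using assms by (simp add: prob_split)
qed

text \<open>
  For \<open>j \<le> k\<close> the product of the two probabilities is the joint probability times
  \<open>(q)\<^sub>k / (q)\<^sub>n \<cdot> (q)\<^sub>n\<^sub>-\<^sub>j / (q)\<^sub>k\<^sub>-\<^sub>j\<close>. Here the first quotient is at least \<open>1\<close> by
  monotonicity, and the second is a product over exponents greater than \<open>k - j\<close> and hence close to \<open>1\<close>.
  The exponent \<open>max j k - min j k\<close> is \<open>|k - j|\<close> in natural numbers.
\<close>

lemma cov_split_le:
  assumes q: "0 < q" "q < 1" and "j \<le> n" "k \<le> n"
  shows "measure_pmf.prob (mallows n q) ({\<sigma>. splits_at \<sigma> j} \<inter> {\<sigma>. splits_at \<sigma> k})
      - measure_pmf.prob (mallows n q) {\<sigma>. splits_at \<sigma> j} * measure_pmf.prob (mallows n q) {\<sigma>. splits_at \<sigma> k}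
    \<le> q ^ (max j k - min j k) / (1 - q)"
  using assms(3,4)
proof (induction j k rule: linorder_wlog)
  case (sym j k)
  then show ?case by (simp add: Int_commute mult.commute max.commute min.commute)
next
  case (le j k)
  let ?Q = "q_poch q" and ?P = "measure_pmf.prob (mallows n q)"
  define J where "J = ?P ({\<sigma>. splits_at \<sigma> j} \<inter> {\<sigma>. splits_at \<sigma> k})"
  have Q: "?Q m > 0" for m using q by (intro q_poch_pos) auto
  have "?Q n \<le> ?Q k" using q le by (intro q_poch_antimono) auto
  then have "1 * (?Q (n - j) / ?Q (k - j)) \<le> ?Q k / ?Q n * (?Q (n - j) / ?Q (k - j))"
    using Q[of n] Q[of "n - j"] Q[of "k - j"] by (intro mult_right_mono) auto
  moreover have "1 - q ^ (k - j) / (1 - q) \<le> ?Q (n - j) / ?Q (k - j)"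
    using q le by (intro q_poch_ratio_ge) auto
  ultimately have ratio: "1 - q ^ (k - j) / (1 - q) \<le> ?Q k / ?Q n * (?Q (n - j) / ?Q (k - j))"
    by linarith
  have "?P {\<sigma>. splits_at \<sigma> j} * ?P {\<sigma>. splits_at \<sigma> k} = J * (?Q k / ?Q n * (?Q (n - j) / ?Q (k - j)))"
    unfolding J_def using q le Q[of n] Q[of "k - j"]
    by (simp add: prob_split prob_split_pair field_simps)
  also have "\<dots> \<ge> J * (1 - q ^ (k - j) / (1 - q))"
    using ratio by (intro mult_left_mono) (auto simp: J_def)
  finally have "J - ?P {\<sigma>. splits_at \<sigma> j} * ?P {\<sigma>. splits_at \<sigma> k} \<le> J * (q ^ (k - j) / (1 - q))"
    by (simp add: algebra_simps)
  also have "\<dots> \<le> 1 * (q ^ (k - j) / (1 - q))"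
    using q by (intro mult_right_mono) (auto simp: J_def)
  finally show ?case using le(1) by (simp add: J_def)
qed

lemma sum_power_dist_le:
  fixes q :: real
  assumes "0 < q" "q < 1"
  shows "(\<Sum>k\<in>{1..<n}. q ^ (max j k - min j k)) \<le> 2 / (1 - q)"
proof -
  have geo: "(\<Sum>i<m. q ^ i) \<le> 1 / (1 - q)" for m
  proof -
    have "(\<Sum>i<m. q ^ i) = (1 - q ^ m) / (1 - q)"
      using assms by (simp add: sum_gp_strict)
    also have "\<dots> \<le> 1 / (1 - q)" using assms by (intro divide_right_mono) auto
    finally show ?thesis .
  qed
  have "(\<Sum>k\<in>{1..<n}. q ^ (max j k - min j k))
      \<le> (\<Sum>k\<in>{1..j} \<union> {j..<n}. q ^ (max j k - min j k))"
    using assms by (intro sum_mono2) auto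
  also have "\<dots> \<le> (\<Sum>k\<in>{1..j}. q ^ (max j k - min j k)) + (\<Sum>k\<in>{j..<n}. q ^ (max j k - min j k))"
    using assms by (subst sum_Un) (auto intro!: sum_nonneg)
  also have "(\<Sum>k\<in>{1..j}. q ^ (max j k - min j k)) = (\<Sum>i<j. q ^ i)"
    by (rule sum.reindex_bij_witness[where i = "\<lambda>i. j - i" and j = "\<lambda>k. j - k"]) auto
  also have "(\<Sum>k\<in>{j..<n}. q ^ (max j k - min j k)) = (\<Sum>i<n - j. q ^ i)"
    by (rule sum.reindex_bij_witness[where i = "\<lambda>i. j + i" and j = "\<lambda>k. k - j"]) auto
  also have "(\<Sum>i<j. q ^ i) + (\<Sum>i<n - j. q ^ i) \<le> 2 / (1 - q)"
    using geo[of j] geo[of "n - j"] by simp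
  finally show ?thesis by simp
qed

lemma sum_cov_split_le:
  fixes n :: nat
  assumes q: "0 < q" "q < 1"
  defines "P \<equiv> measure_pmf.prob (mallows n q)"
  shows "(\<Sum>j\<in>{1..<n}. \<Sum>k\<in>{1..<n}.
      P ({\<sigma>. splits_at \<sigma> j} \<inter> {\<sigma>. splits_at \<sigma> k}) - P {\<sigma>. splits_at \<sigma> j} * P {\<sigma>. splits_at \<sigma> k})
    \<le> 2 * real n / (1 - q)\<^sup>2" (is "?L \<le> _")
proof -
  have "?L \<le> (\<Sum>j\<in>{1..<n}. \<Sum>k\<in>{1..<n}. q ^ (max j k - min j k) / (1 - q))"
    unfolding P_def using q by (intro sum_mono cov_split_le) auto
  also have "\<dots> = (\<Sum>j\<in>{1..<n}. (\<Sum>k\<in>{1..<n}. q ^ (max j k - min j k)) / (1 - q))"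
    by (simp add: sum_divide_distrib)
  also have "\<dots> \<le> (\<Sum>j\<in>{1..<n}. 2 / (1 - q) / (1 - q))"
    using q by (intro sum_mono divide_right_mono sum_power_dist_le) auto
  also have "\<dots> = real (n - 1) * (2 / (1 - q)\<^sup>2)" by (simp add: power2_eq_square)
  also have "\<dots> \<le> real n * (2 / (1 - q)\<^sup>2)" by (intro mult_right_mono) auto
  finally show ?thesis by (simp add: mult.commute)
qed

section \<open>Concentration and the diameter bound\<close>

text \<open>Chebyshev's inequality for the number of events that occur.\<close>

lemma (in prob_space) prob_count_deviation_le:
  assumes "finite I" and A: "\<And>i. i \<in> I \<Longrightarrow> A i \<in> events" and "t > 0"
  shows "prob {x \<in> space M. real (card {i \<in> I. x \<in> A i}) \<le> (\<Sum>i\<in>I. prob (A i)) - t}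
    \<le> (\<Sum>i\<in>I. \<Sum>j\<in>I. prob (A i \<inter> A j) - prob (A i) * prob (A j)) / t\<^sup>2"
proof -
  define N where "N x = (\<Sum>i\<in>I. indicat_real (A i) x)" for x
  have [measurable]: "N \<in> borel_measurable M" unfolding N_def using A by measurable
  have card: "real (card {i \<in> I. x \<in> A i}) = N x" for x
    unfolding N_def using \<open>finite I\<close> by (simp add: indicator_def sum.If_cases Int_def)
  have ind: "integrable M (indicat_real (A i \<inter> A j))" "integrable M (indicat_real (A i))"
    if "i \<in> I" "j \<in> I" for i j
    using A that by (auto intro!: integrable_real_indicator simp: less_top[symmetric])
  have N2: "(N x)\<^sup>2 = (\<Sum>i\<in>I. \<Sum>j\<in>I. indicat_real (A i \<inter> A j) x)" for x
    by (simp add: N_def power2_eq_square sum_product indicator_inter_arith)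
  have intN: "integrable M N" unfolding N_def using ind by (intro Bochner_Integration.integrable_sum) auto
  have intN2: "integrable M (\<lambda>x. (N x)\<^sup>2)"
    unfolding N2 using ind by (intro Bochner_Integration.integrable_sum) auto
  have EN: "expectation N = (\<Sum>i\<in>I. prob (A i))"
    unfolding N_def using ind A sets.sets_into_space[OF A]
    by (subst Bochner_Integration.integral_sum) (auto intro!: sum.cong simp: Int_absorb2)
  have EN2: "expectation (\<lambda>x. (N x)\<^sup>2) = (\<Sum>i\<in>I. \<Sum>j\<in>I. prob (A i \<inter> A j))"
  proof -
    have "expectation (\<lambda>x. (N x)\<^sup>2) = (\<Sum>i\<in>I. \<Sum>j\<in>I. expectation (indicat_real (A i \<inter> A j)))"
      unfolding N2 using ind
      by (subst Bochner_Integration.integral_sum)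
        (auto intro!: Bochner_Integration.integrable_sum sum.cong Bochner_Integration.integral_sum)
    also have "\<dots> = (\<Sum>i\<in>I. \<Sum>j\<in>I. prob (A i \<inter> A j))"
      using A sets.sets_into_space[OF A] by (intro sum.cong refl) (auto simp: Int_absorb2 le_infI1)
    finally show ?thesis .
  qed
  have "prob {x \<in> space M. real (card {i \<in> I. x \<in> A i}) \<le> (\<Sum>i\<in>I. prob (A i)) - t}
      \<le> prob {x \<in> space M. t \<le> \<bar>N x - expectation N\<bar>}"
    unfolding card EN by (intro finite_measure_mono) auto
  also have "\<dots> \<le> variance N / t\<^sup>2"
    using intN2 \<open>t > 0\<close> by (intro Chebyshev_inequality) auto
  also have "variance N = (\<Sum>i\<in>I. \<Sum>j\<in>I. prob (A i \<inter> A j) - prob (A i) * prob (A j))"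
    by (subst variance_eq[OF intN intN2])
      (simp add: EN EN2 power2_eq_square[of "sum _ _"] sum_product sum_subtractf)
  finally show ?thesis .
qed

text \<open>
  With \<open>\<phi> = exp (- 1 / \<epsilon>\<^sup>2)\<close> the mean number of split points is at least \<open>\<phi> (n - 1) \<ge> \<phi> n / 2\<close> and its
  variance is at most \<open>2 n / \<epsilon>\<^sup>2\<close>. Chebyshev's inequality for the deviation \<open>t = \<phi> n / 4\<close> then bounds the
  probability of fewer than \<open>\<phi> n / 4\<close> split points by \<open>1 / (D n)\<close>, where \<open>D = \<epsilon>\<^sup>2 \<phi>\<^sup>2 / 32\<close>. With
  \<open>c = D\<^sup>2\<close>, the condition \<open>n \<ge> 1 / c\<close> says \<open>1 / D \<le> \<surd>n\<close>, so that this is at most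
  \<open>n\<^bsup>-1/2\<^esup>\<close>; moreover \<open>c \<le> \<phi> / 4\<close>, and \<open>c \<le> 1 / 2\<close> ensures \<open>n \<ge> 2\<close>.
\<close>

theorem theorem1p3:
  fixes \<epsilon> :: real
  assumes "0 < \<epsilon>" and "\<epsilon> < 1"
  shows "\<exists>c::real. c > 0 \<and>
    (\<forall>(n::nat) (q::real). real n \<ge> 1 / c \<longrightarrow> 0 < q \<longrightarrow> q \<le> 1 - \<epsilon> \<longrightarrow>
       measure_pmf.prob (tangled_path n q) {G. diam (with_proj G) < ereal (c * real n)}
         \<le> real n powr (- 1 / 10))"
proof -
  define \<phi> where "\<phi> = exp (- 1 / \<epsilon>\<^sup>2)"
  define D where "D = \<epsilon>\<^sup>2 * \<phi>\<^sup>2 / 32"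
  have \<phi>: "0 < \<phi>" "\<phi> \<le> 1" by (auto simp: \<phi>_def)
  have "\<epsilon>\<^sup>2 \<le> 1" "\<phi>\<^sup>2 \<le> \<phi>" "\<phi>\<^sup>2 \<le> 1"
    using assms \<phi> by (auto simp: power2_eq_square mult_le_one)
  then have D: "0 < D" "D \<le> \<phi> / 32" "D \<le> 1 / 32"
    using assms \<phi> mult_mono[of "\<epsilon>\<^sup>2" 1 "\<phi>\<^sup>2" \<phi>] by (auto simp: D_def mult_le_one)
  then have D2: "0 < D\<^sup>2" "D\<^sup>2 \<le> \<phi> / 4" "D\<^sup>2 \<le> 1 / 2"
    using mult_mono[of D 1 D "\<phi> / 32"] mult_mono[of D 1 D "1 / 32"] \<phi>
    by (auto simp: power2_eq_square)
  show ?thesis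
  proof (intro exI[of _ "D\<^sup>2"] conjI allI impI)
    show "0 < D\<^sup>2" by fact
    fix n :: nat and q :: real
    assume n: "1 / D\<^sup>2 \<le> real n" and q0: "0 < q" and q\<epsilon>: "q \<le> 1 - \<epsilon>"
    let ?M = "mallows n q" and ?S = "\<lambda>k. {\<sigma>. splits_at \<sigma> k}"
    let ?N = "\<lambda>\<sigma>. real (card {k \<in> {1..<n}. splits_at \<sigma> k})"
    let ?mean = "\<Sum>k\<in>{1..<n}. measure_pmf.prob ?M (?S k)"
    have q1: "q < 1" using q\<epsilon> assms by simp
    have "2 \<le> 1 / D\<^sup>2" using D2 by (simp add: field_simps)
    with n have n2: "real n \<ge> 2" by linarith
    then have npos: "real n > 0" by simp
    have "1 / (1 - q)\<^sup>2 \<le> 1 / \<epsilon>\<^sup>2"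
      using assms q\<epsilon> by (intro divide_left_mono power_mono mult_pos_pos) auto
    then have p_ge: "\<phi> \<le> measure_pmf.prob ?M (?S k)" if "k \<le> n" for k
      using prob_split_ge[OF q0 q1 that] unfolding \<phi>_def
      by (smt (verit) exp_le_cancel_iff minus_divide_left)
    have "\<phi> * real n / 2 \<le> real (n - 1) * \<phi>"
      using n2 \<phi> by (simp add: of_nat_diff field_simps)
    also have "\<dots> \<le> ?mean"
      using sum_bounded_below[of "{1..<n}" \<phi> "\<lambda>k. measure_pmf.prob ?M (?S k)"] p_ge by simp
    finally have mean: "\<phi> * real n / 2 \<le> ?mean" .
    define t where "t = \<phi> * real n / 4"
    have t: "0 < t" using \<phi> npos by (simp add: t_def)
    have small: "?N \<sigma> \<le> ?mean - t"
      if "\<sigma> \<in> set_pmf ?M" "diam (with_proj (tangled_graph n \<sigma>)) < ereal (D\<^sup>2 * real n)" for \<sigma>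
    proof -
      have "\<sigma> permutes {1..n}"
        using that(1) by (auto simp: set_pmf_iff pmf_mallows[OF q0] mallows_density_def split: if_splits)
      then have "ereal (?N \<sigma>) \<le> diam (with_proj (tangled_graph n \<sigma>))"
        using n2 by (intro diam_tangled_ge) auto
      from this that(2) have "ereal (?N \<sigma>) < ereal (D\<^sup>2 * real n)" by (rule order_le_less_trans)
      then have "?N \<sigma> < D\<^sup>2 * real n" by simp
      also have "\<dots> \<le> t" using D2(2) mult_right_mono[of "D\<^sup>2" "\<phi> / 4" "real n"] by (simp add: t_def)
      finally show ?thesis using mean by (simp add: t_def)
    qed
    have "measure_pmf.prob (tangled_path n q) {G. diam (with_proj G) < ereal (D\<^sup>2 * real n)}
        = measure_pmf.prob ?M {\<sigma>. diam (with_proj (tangled_graph n \<sigma>)) < ereal (D\<^sup>2 * real n)}"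
      by (simp add: tangled_path_def vimage_def)
    also have "\<dots> \<le> measure_pmf.prob ?M {\<sigma>. ?N \<sigma> \<le> ?mean - t}"
      using small by (intro measure_pmf.finite_measure_mono_AE) (auto simp: AE_measure_pmf_iff)
    also have "\<dots> \<le> 2 * real n / (1 - q)\<^sup>2 / t\<^sup>2"
    proof -
      have "measure_pmf.prob ?M {\<sigma>. ?N \<sigma> \<le> ?mean - t} \<le> (\<Sum>j\<in>{1..<n}. \<Sum>k\<in>{1..<n}.
          measure_pmf.prob ?M (?S j \<inter> ?S k) - measure_pmf.prob ?M (?S j) * measure_pmf.prob ?M (?S k)) / t\<^sup>2"
        using measure_pmf.prob_count_deviation_le[of "{1..<n}" ?S ?M t] t by simp
      also have "\<dots> \<le> 2 * real n / (1 - q)\<^sup>2 / t\<^sup>2"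
        using sum_cov_split_le[OF q0 q1] by (intro divide_right_mono) auto
      finally show ?thesis .
    qed
    also have "\<dots> \<le> 2 * real n / \<epsilon>\<^sup>2 / t\<^sup>2"
      using assms q\<epsilon> by (intro divide_right_mono divide_left_mono power_mono mult_pos_pos) auto
    also have "\<dots> = 1 / (D * real n)"
      using npos assms \<phi> by (simp add: D_def t_def field_simps power2_eq_square)
    also have "\<dots> \<le> real n powr (- 1 / 2)"
    proof -
      have "1 / D = sqrt (1 / D\<^sup>2)" using D by (simp add: real_sqrt_divide)
      also have "\<dots> \<le> sqrt (real n)" using n by simp
      finally have "1 / D / real n \<le> sqrt (real n) / real n"
        using npos by (intro divide_right_mono) auto
      also have "\<dots> = 1 / sqrt (real n)" using npos by (simp add: real_div_sqrt field_simps)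
      also have "\<dots> = real n powr (- 1 / 2)"
        using npos by (simp add: powr_half_sqrt[symmetric] powr_minus_divide)
      finally show ?thesis by simp
    qed
    also have "\<dots> \<le> real n powr (- 1 / 10)"
      using n2 by (intro powr_mono) auto
    finally show "measure_pmf.prob (tangled_path n q) {G. diam (with_proj G) < ereal (D\<^sup>2 * real n)}
        \<le> real n powr (- 1 / 10)" .
  qed
qed

end
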